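(* Let $G/\Gamma$ be a nilmanifold with filtration $(G_i)$, let $g\in\mathrm{poly}(\mathbb Z^\ell,G)$ with $g(0)=\mathrm{id}_G$, and let $\vec h\in\mathbb Z^\ell$. Define \[g_{\vec h}(\vec n)=\big(\{g_{\mathrm{lin}}(\vec h)\}^{-1}g_2(\vec n+\vec h)g_{\mathrm{lin}}(\vec n+\vec h)[g_{\mathrm{lin}}(\vec h)]^{-1},\ g(\vec n)\big).\] Then $g_{\vec h}\in\mathrm{poly}(\mathbb Z^\ell,G^\square)$, where $G^\square$ carries the filtration $(G^\square)_0=(G^\square)_1=G^\square$ and $(G^\square)_i=G_i\times_{G_{i+1}}G_i$ for $i\ge1$.
   Context: $g_{\mathrm{lin}}(\vec n)=g(e_1)^{n_1}\cdots g(e_\ell)^{n_\ell}$ and $g_2(\vec n)=g(\vec n)g_{\mathrm{lin}}(\vec n)^{-1}$. For a normal subgroup $H$ of $G$, $G\times_HG=\{(g,g')\in G^2:g'g^{-1}\in H\}$, and $G^\square=G\times_{G_2}G$. Every $x\in G$ factors uniquely as $x=\{x\}[x]$ with $[x]\in\Gamma$ and $\psi(\{x\})\in[-1/2,1/2)^d$, where $\psi$ denotes Mal'cev coordinates of the second kind ($x=\exp(t_1X_1)\cdots\exp(t_dX_d)$, $\psi(x)=(t_i)$). A filtration satisfies $G=G_0=G_1\supseteq G_2\supseteq\cdots$, $[G_i,G_j]\subseteq G_{i+j}$, $G_i$ trivial for large $i$; $\mathrm{poly}(\mathbb Z^\ell,H)$ for a filtered group $H$ consists of maps $\vec n\mapsto\prod_{\vec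 i}h_{\vec i}^{\binom{\vec n}{\vec i}}$ with $h_{\vec i}\in H_{|\vec i|}$. *)

theory Defs
  imports Complex_Main "HOL-Algebra.Group"
begin

definition filtration :: "('a, 'b) monoid_scheme \<Rightarrow> (nat \<Rightarrow> 'a set) \<Rightarrow> bool" where
  "filtration G Gs \<longleftrightarrow>
     Gs 0 = carrier G \<and> Gs 1 = carrier G \<and>
     (\<forall>i. subgroup (Gs i) G) \<and>
     (\<forall>i. Gs (Suc i) \<subseteq> Gs i) \<and>
     (\<forall>i j x y. x \<in> Gs i \<longrightarrow> y \<in> Gs j \<longrightarrow>
        x \<otimes>\<^bsub>G\<^esub> y \<otimes>\<^bsub>G\<^esub> inv\<^bsub>G\<^esub> x \<otimes>\<^bsub>G\<^esub> inv\<^bsub>G\<^esub> y \<in> Gs (i + j)) \<and>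
     (\<exists>s. \<forall>i\<ge>s. Gs i = {\<one>\<^bsub>G\<^esub>})"

definition list_prod :: "('a, 'b) monoid_scheme \<Rightarrow> 'a list \<Rightarrow> 'a" where
  "list_prod G xs = foldr (\<lambda>x acc. x \<otimes>\<^bsub>G\<^esub> acc) xs \<one>\<^bsub>G\<^esub>"

fun multi_indices :: "nat \<Rightarrow> nat \<Rightarrow> nat list list" where
  "multi_indices 0 s = [[]]"
| "multi_indices (Suc l) s = concat (map (\<lambda>a. map (\<lambda>r. a # r) (multi_indices l s)) [0..<Suc s])"

definition multi_indices_upto :: "nat \<Rightarrow> nat \<Rightarrow> nat list list" where
  "multi_indices_upto l s = filter (\<lambda>i. sum_list i \<le> s) (multi_indices l s)"

definition int_binom :: "int \<Rightarrow> nat \<Rightarrow> int" where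
  "int_binom a k = (\<Prod>i<k. a - int i) div fact k"

definition multi_binom :: "int list \<Rightarrow> nat list \<Rightarrow> int" where
  "multi_binom n i = (\<Prod>j<length i. int_binom (n ! j) (i ! j))"

definition poly_seq :: "('a, 'b) monoid_scheme \<Rightarrow> (nat \<Rightarrow> 'a set) \<Rightarrow> nat \<Rightarrow> (int list \<Rightarrow> 'a) \<Rightarrow> bool" where
  "poly_seq H Hs l g \<longleftrightarrow>
     (\<exists>s (h :: nat list \<Rightarrow> 'a).
        (\<forall>i \<in> set (multi_indices_upto l s). h i \<in> Hs (sum_list i)) \<and>
        (\<forall>n. length n = l \<longrightarrow>
           g n = list_prod H (map (\<lambda>i. h i [^]\<^bsub>H\<^esub> multi_binom n i) (multi_indices_upto l s))))"

definition unit_vec :: "nat \<Rightarrow> nat \<Rightarrow> int list" where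
  "unit_vec l j = map (\<lambda>k. if k = j then 1 else 0) [0..<l]"

definition g_lin :: "('a, 'b) monoid_scheme \<Rightarrow> nat \<Rightarrow> (int list \<Rightarrow> 'a) \<Rightarrow> int list \<Rightarrow> 'a" where
  "g_lin G l g n = list_prod G (map (\<lambda>j. g (unit_vec l j) [^]\<^bsub>G\<^esub> (n ! j)) [0..<l])"

definition g_two :: "('a, 'b) monoid_scheme \<Rightarrow> nat \<Rightarrow> (int list \<Rightarrow> 'a) \<Rightarrow> int list \<Rightarrow> 'a" where
  "g_two G l g n = g n \<otimes>\<^bsub>G\<^esub> inv\<^bsub>G\<^esub> (g_lin G l g n)"

definition vec_add :: "int list \<Rightarrow> int list \<Rightarrow> int list" where
  "vec_add n m = map2 (+) n m"

definition in_fund_box :: "nat \<Rightarrow> (nat \<Rightarrow> real) \<Rightarrow> bool" where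
  "in_fund_box d t \<longleftrightarrow> (\<forall>k<d. -1/2 \<le> t k \<and> t k < 1/2)"

definition unique_frac_factorization ::
  "('a, 'b) monoid_scheme \<Rightarrow> 'a set \<Rightarrow> ('a \<Rightarrow> nat \<Rightarrow> real) \<Rightarrow> nat \<Rightarrow> bool" where
  "unique_frac_factorization G \<Gamma> \<psi> d \<longleftrightarrow>
     (\<forall>x \<in> carrier G. \<exists>!y. y \<in> carrier G \<and> in_fund_box d (\<psi> y) \<and> inv\<^bsub>G\<^esub> y \<otimes>\<^bsub>G\<^esub> x \<in> \<Gamma>)"

definition frac_part :: "('a, 'b) monoid_scheme \<Rightarrow> 'a set \<Rightarrow> ('a \<Rightarrow> nat \<Rightarrow> real) \<Rightarrow> nat \<Rightarrow> 'a \<Rightarrow> 'a" where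
  "frac_part G \<Gamma> \<psi> d x = (THE y. y \<in> carrier G \<and> in_fund_box d (\<psi> y) \<and> inv\<^bsub>G\<^esub> y \<otimes>\<^bsub>G\<^esub> x \<in> \<Gamma>)"

definition int_part :: "('a, 'b) monoid_scheme \<Rightarrow> 'a set \<Rightarrow> ('a \<Rightarrow> nat \<Rightarrow> real) \<Rightarrow> nat \<Rightarrow> 'a \<Rightarrow> 'a" where
  "int_part G \<Gamma> \<psi> d x = inv\<^bsub>G\<^esub> (frac_part G \<Gamma> \<psi> d x) \<otimes>\<^bsub>G\<^esub> x"

definition fiber_prod :: "('a, 'b) monoid_scheme \<Rightarrow> 'a set \<Rightarrow> 'a set \<Rightarrow> ('a \<times> 'a) set" where
  "fiber_prod G A H = {(x, y). x \<in> A \<and> y \<in> A \<and> y \<otimes>\<^bsub>G\<^esub> inv\<^bsub>G\<^esub> x \<in> H}"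

definition square_group :: "('a, 'b) monoid_scheme \<Rightarrow> (nat \<Rightarrow> 'a set) \<Rightarrow> ('a \<times> 'a) monoid" where
  "square_group G Gs = (G \<times>\<times> G)\<lparr>carrier := fiber_prod G (carrier G) (Gs 2)\<rparr>"

definition square_filtration :: "('a, 'b) monoid_scheme \<Rightarrow> (nat \<Rightarrow> 'a set) \<Rightarrow> nat \<Rightarrow> ('a \<times> 'a) set" where
  "square_filtration G Gs i =
     (if i = 0 then fiber_prod G (carrier G) (Gs 2) else fiber_prod G (Gs i) (Gs (i + 1)))"

end

theory Submission
  imports Defs "HOL-Algebra.Generated_Groups"
begin

text \<open>
  Write \<open>k = g_lin h = a b\<close> with \<open>a = {k}\<close>, \<open>b = [k]\<close>. The first component of \<open>g_h\<close> is
  \<open>a\<inverse> g(n + h) b\<inverse>\<close>, so \<open>g_h = (w\<inverse>, 1) (g, g)\<close> with \<open>w(n) = g(n) b g(n + h)\<inverse> a\<close>. Conjugates of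
  constants and derivatives of \<open>g\<close> are polynomial for the filtration shifted by one, hence so is
  \<open>w\<close>, and therefore \<open>g_h\<close> is polynomial for the levels \<open>G_i \<times>_{G_{i+1}} G_i\<close>. At \<open>n = 0\<close> the
  components agree modulo \<open>G_2\<close> because \<open>g\<close> and \<open>g_lin\<close> do.

  To pass from such closure properties to an ordered product of binomial powers, one takes the
  smallest class of sequences that contains the elementary ones \<open>x ^ p(n)\<close> and is closed under the
  filtered group operations. Derivatives raise the level in this class, and this suffices to
  interpolate any of its members on the simplex \<open>|i| \<le> s\<close> with coefficients of the right level;
  by nilpotency agreement on the simplex is agreement everywhere.
\<close>

section \<open>Integer vectors and integer-valued polynomials\<close>

lemma length_vec_add [simp]: "length (vec_add n m) = min (length n) (length m)"
  by (simp add: vec_add_def)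

lemma nth_vec_add [simp]: "j < length n \<Longrightarrow> j < length m \<Longrightarrow> vec_add n m ! j = n ! j + m ! j"
  by (simp add: vec_add_def)

lemma length_unit_vec [simp]: "length (unit_vec l j) = l"
  by (simp add: unit_vec_def)

lemma vec_add_unit_vec: "length n = l \<Longrightarrow> t < l \<Longrightarrow> vec_add n (unit_vec l t) = n[t := n ! t + 1]"
  by (rule nth_equalityI) (auto simp: unit_vec_def nth_list_update)

lemma vec_add_unit_vec_map_int:
  "length i = l \<Longrightarrow> t < l \<Longrightarrow> vec_add (map int i) (unit_vec l t) = map int (i[t := Suc (i ! t)])"
  by (simp add: vec_add_unit_vec map_update add.commute)

lemma vec_add_replicate_0: "length n = l \<Longrightarrow> vec_add (replicate l 0) n = n"
  by (rule nth_equalityI) auto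

text \<open>The step is an equivalence because a coordinate may have to move to 0 from either side;
  the coordinates are cleared from left to right.\<close>

lemma int_vec_coordinate_induct:
  fixes n :: "int list"
  assumes zero: "Q (replicate l 0)"
    and step: "\<And>n t. length n = l \<Longrightarrow> t < l \<Longrightarrow> Q (n[t := n ! t + 1]) \<longleftrightarrow> Q n"
    and n: "length n = l"
  shows "Q n"
proof -
  have upd: "Q (n[t := x]) \<longleftrightarrow> Q (n[t := 0])" if "length n = l" "t < l" for n t and x :: int
  proof (induction x rule: int_induct[where k = 0])
    case (step1 i)
    then show ?case using step[of "n[t := i]" t] that by simp
  next
    case (step2 i)
    then show ?case using step[of "n[t := i - 1]" t] that by simp
  qed simp
  have "m \<le> l \<Longrightarrow> Q (replicate m 0 @ drop m n) \<longleftrightarrow> Q n" for m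
  proof (induction m)
    case (Suc m)
    have "(replicate m 0 @ drop m n)[m := 0] = replicate (Suc m) 0 @ drop (Suc m) n"
      using Suc.prems n
      by (intro nth_equalityI) (auto simp: nth_append nth_list_update less_Suc_eq simp del: replicate_Suc)
    moreover have "(replicate m 0 @ drop m n)[m := n ! m] = replicate m 0 @ drop m n"
      using Suc.prems n by (intro nth_equalityI) (auto simp: nth_append nth_list_update)
    ultimately show ?case
      using upd[of "replicate m 0 @ drop m n" m "n ! m"] Suc n by simp
  qed simp
  moreover have "replicate l 0 @ drop l n = replicate l 0" using n by simp
  ultimately show ?thesis using zero by (metis order_refl)
qed

text \<open>Degree is measured by iterated differences in arbitrary directions, not by coefficients:
  this is the form in which \<open>pseq_derivative\<close> uses it.\<close>

primrec degree_le :: "nat \<Rightarrow> nat \<Rightarrow> (int list \<Rightarrow> int) \<Rightarrow> bool" where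
  "degree_le l 0 p \<longleftrightarrow> (\<forall>h n. length h = l \<longrightarrow> length n = l \<longrightarrow> p (vec_add n h) = p n)"
| "degree_le l (Suc k) p \<longleftrightarrow> (\<forall>h. length h = l \<longrightarrow> degree_le l k (\<lambda>n. p (vec_add n h) - p n))"

lemma degree_le_cong:
  "degree_le l k p \<Longrightarrow> (\<And>n. length n = l \<Longrightarrow> p n = q n) \<Longrightarrow> degree_le l k q"
proof (induction k arbitrary: p q)
  case 0
  show ?case unfolding degree_le.simps
  proof (intro allI impI)
    fix h n :: "int list" assume "length h = l" "length n = l"
    then show "q (vec_add n h) = q n"
      using 0(1) by (simp flip: 0(2))
  qed
next
  case (Suc k)
  show ?case unfolding degree_le.simps
  proof (intro allI impI)
    fix h :: "int list" assume "length h = l"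
    then show "degree_le l k (\<lambda>n. q (vec_add n h) - q n)"
      using Suc.IH[of "\<lambda>n. p (vec_add n h) - p n" "\<lambda>n. q (vec_add n h) - q n"] Suc.prems by simp
  qed
qed

lemma degree_le_Suc: "degree_le l k p \<Longrightarrow> degree_le l (Suc k) p"
proof (induction k arbitrary: p)
  case 0
  then show ?case by auto
next
  case (Suc k)
  have "degree_le l (Suc k) (\<lambda>n. p (vec_add n h) - p n)" if "length h = l" for h
    using Suc.prems that by (intro Suc.IH) simp
  then show ?case by (subst degree_le.simps(2)) blast
qed

lemma degree_le_mono: "degree_le l k p \<Longrightarrow> k \<le> m \<Longrightarrow> degree_le l m p"
  by (induction m) (auto simp: le_Suc_eq simp del: degree_le.simps intro: degree_le_Suc)

lemma degree_le_add: "degree_le l k p \<Longrightarrow> degree_le l k q \<Longrightarrow> degree_le l k (\<lambda>n. p n + q n)"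
proof (induction k arbitrary: p q)
  case (Suc k)
  have "degree_le l k (\<lambda>n. (p (vec_add n h) - p n) + (q (vec_add n h) - q n))" if "length h = l" for h
    using Suc.prems that by (intro Suc.IH) auto
  then show ?case by (simp add: algebra_simps)
qed auto

text \<open>Discrete Leibniz rule: the difference of \<open>p * q\<close> is
  \<open>Dp * q + p * Dq + Dp * Dq\<close>, and each term has smaller total degree. Degree 0 is
  split off because there the difference vanishes instead of dropping in degree.\<close>

lemma degree_le_mult:
  "degree_le l k p \<Longrightarrow> degree_le l m q \<Longrightarrow> degree_le l (k + m) (\<lambda>n. p n * q n)"
proof (induction "k + m" arbitrary: k m p q rule: less_induct)
  case less
  let ?D = "\<lambda>h p n. p (vec_add n h) - p n :: int"
  show ?case
  proof (cases k)
    case 0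
    show ?thesis
    proof (cases m)
      case 0
      with \<open>k = 0\<close> less.prems show ?thesis by simp
    next
      case (Suc m')
      have "degree_le l m' (?D h (\<lambda>n. p n * q n))" if "length h = l" for h
      proof (rule degree_le_cong)
        have "degree_le l (0 + m') (\<lambda>n. p n * ?D h q n)"
          using less.prems that \<open>k = 0\<close> Suc by (intro less.hyps) auto
        then show "degree_le l m' (\<lambda>n. p n * ?D h q n)" by simp
      qed (use less.prems that \<open>k = 0\<close> in \<open>auto simp: algebra_simps\<close>)
      then show ?thesis using \<open>k = 0\<close> Suc by simp
    qed
  next
    case (Suc k')
    show ?thesis
    proof (cases m)
      case 0
      have "degree_le l k' (?D h (\<lambda>n. p n * q n))" if "length h = l" for h
      proof (rule degree_le_cong)
        have "degree_le l (k' + 0) (\<lambda>n. ?D h p n * q n)"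
          using less.prems that \<open>k = Suc k'\<close> 0 by (intro less.hyps) auto
        then show "degree_le l k' (\<lambda>n. ?D h p n * q n)" by simp
      qed (use less.prems that \<open>m = 0\<close> in \<open>auto simp: algebra_simps\<close>)
      then show ?thesis using \<open>k = Suc k'\<close> 0 by simp
    next
      case (Suc m')
      have "degree_le l (k' + m) (?D h (\<lambda>n. p n * q n))" if h: "length h = l" for h
      proof (rule degree_le_cong)
        have p: "degree_le l k' (?D h p)" and q: "degree_le l m' (?D h q)"
          using less.prems h \<open>k = Suc k'\<close> Suc by simp_all
        have "degree_le l (k' + m) (\<lambda>n. ?D h p n * q n)"
          using p less.prems(2) \<open>k = Suc k'\<close> by (intro less.hyps) auto
        moreover have "degree_le l (k + m') (\<lambda>n. p n * ?D h q n)"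
          using q less.prems(1) Suc by (intro less.hyps) auto
        moreover
        have "degree_le l (k' + m') (\<lambda>n. ?D h p n * ?D h q n)"
          using p q \<open>k = Suc k'\<close> Suc by (intro less.hyps) auto
        then have "degree_le l (k' + m) (\<lambda>n. ?D h p n * ?D h q n)"
          by (rule degree_le_mono) (simp add: Suc)
        ultimately show "degree_le l (k' + m)
            (\<lambda>n. ?D h p n * q n + p n * ?D h q n + ?D h p n * ?D h q n)"
          using \<open>k = Suc k'\<close> Suc by (intro degree_le_add) (simp_all del: degree_le.simps)
      qed (auto simp: algebra_simps)
      then show ?thesis using \<open>k = Suc k'\<close> by simp
    qed
  qed
qed

lemma degree_le_cancel:
  "degree_le l k (\<lambda>n. c * p n) \<Longrightarrow> c \<noteq> 0 \<Longrightarrow> degree_le l k p"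
proof (induction k arbitrary: p)
  case (Suc k)
  then show ?case by (simp flip: right_diff_distrib)
qed auto

lemma degree_le_linear: "j < l \<Longrightarrow> degree_le l 1 (\<lambda>n. n ! j - c)"
  by simp

text \<open>Multiplied by \<open>fact k\<close>, the binomial is a product of \<open>k\<close>
  linear factors; \<open>degree_le_cancel\<close> removes the factorial without leaving the
  integers.\<close>

lemma degree_le_int_binom:
  assumes "j < l" shows "degree_le l k (\<lambda>n. int_binom (n ! j) k)"
proof -
  have "degree_le l k (\<lambda>n. \<Prod>i<k. n ! j - int i)"
  proof (induction k)
    case (Suc k)
    from degree_le_mult[OF this degree_le_linear[OF assms, of "int k"]] show ?case by simp
  qed simp
  moreover have "(\<Prod>i<k. a - int i) = fact k * int_binom a k" for a
    using gbinomial_int_mult_fact[of k a]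
    by (simp add: int_binom_def gbinomial_prod_rev atLeast0LessThan)
  ultimately have "degree_le l k (\<lambda>n. fact k * int_binom (n ! j) k)" by simp
  then show ?thesis by (rule degree_le_cancel) simp
qed

lemma degree_le_multi_binom:
  assumes "length i = l" shows "degree_le l (sum_list i) (\<lambda>n. multi_binom n i)"
proof -
  have "m \<le> l \<Longrightarrow> degree_le l (\<Sum>j<m. i ! j) (\<lambda>n. \<Prod>j<m. int_binom (n ! j) (i ! j))" for m
  proof (induction m)
    case (Suc m)
    with degree_le_mult[OF Suc.IH degree_le_int_binom] show ?case by simp
  qed simp
  from this[of l] show ?thesis
    using assms by (simp add: multi_binom_def sum_list_sum_nth atLeast0LessThan)
qed

section \<open>Binomials at multi-indices and the enumeration of the simplex\<close>

lemma int_binom_of_nat: "int_binom (int a) k = int (a choose k)"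
  using gbinomial_int_binomial[of "int a" k]
  by (simp add: int_binom_def gbinomial_prod_rev atLeast0LessThan)

lemma multi_binom_self: "multi_binom (map int i) i = 1"
  by (simp add: multi_binom_def int_binom_of_nat)

text \<open>Some factor is \<open>j ! t choose i ! t\<close> with \<open>j ! t < i ! t\<close>. With
  \<open>multi_binom_self\<close> this makes the interpolation system unitriangular.\<close>

lemma multi_binom_eq_0:
  assumes "length i = length j" and "\<not> list_all2 (\<le>) i j"
  shows "multi_binom (map int j) i = 0"
proof -
  obtain t where "t < length i" "j ! t < i ! t"
    using assms by (auto simp: list_all2_conv_all_nth not_le)
  then show ?thesis
    using assms(1) by (auto simp: multi_binom_def int_binom_of_nat intro!: exI[of _ t] bexI[of _ t])
qed

lemma multi_binom_0: "length i = l \<Longrightarrow> i \<noteq> replicate l 0 \<Longrightarrow> multi_binom (replicate l 0) i = 0"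
  using multi_binom_eq_0[of i "replicate l 0"]
  by (auto simp: list_all2_conv_all_nth list_eq_iff_nth_eq)

lemma set_multi_indices: "set (multi_indices l s) = {i. length i = l \<and> (\<forall>a\<in>set i. a \<le> s)}"
proof (induction l)
  case (Suc l)
  show ?case
  proof (rule Set.set_eqI)
    fix x show "x \<in> set (multi_indices (Suc l) s) \<longleftrightarrow> x \<in> {i. length i = Suc l \<and> (\<forall>a\<in>set i. a \<le> s)}"
      by (cases x) (auto simp: Suc simp del: upt_Suc)
  qed
qed auto

lemma set_multi_indices_upto: "set (multi_indices_upto l s) = {i. length i = l \<and> sum_list i \<le> s}"
  by (auto simp: multi_indices_upto_def set_multi_indices dest: member_le_sum_list)

text \<open>The enumeration is lexicographic, hence a linear extension of the coordinatewise
  order.\<close>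

lemma sorted_wrt_multi_indices: "sorted_wrt (\<lambda>a b. \<not> list_all2 (\<le>) b a) (multi_indices l s)"
proof (induction l)
  case (Suc l)
  \<comment> \<open>The range of the leading entry is generalised to \<open>m\<close> while the
    tails keep the bound \<open>s\<close>, so that induction on \<open>m\<close> applies.\<close>
  have "sorted_wrt (\<lambda>a b. \<not> list_all2 (\<le>) b a)
      (concat (map (\<lambda>a. map (\<lambda>r. a # r) (multi_indices l s)) [0..<m]))" for m
    by (induction m) (auto simp: sorted_wrt_append sorted_wrt_map Suc)
  from this[of "Suc s"] show ?case by simp
qed simp

lemma sorted_wrt_multi_indices_upto:
  "sorted_wrt (\<lambda>a b. \<not> list_all2 (\<le>) b a) (multi_indices_upto l s)"
  unfolding multi_indices_upto_def by (rule sorted_wrt_filter[OF sorted_wrt_multi_indices])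

section \<open>Polynomial sequences in a prefiltered group\<close>

definition commutator :: "('a, 'b) monoid_scheme \<Rightarrow> 'a \<Rightarrow> 'a \<Rightarrow> 'a" where
  "commutator G x y = x \<otimes>\<^bsub>G\<^esub> y \<otimes>\<^bsub>G\<^esub> inv\<^bsub>G\<^esub> x \<otimes>\<^bsub>G\<^esub> inv\<^bsub>G\<^esub> y"

section \<open>Commutator and conjugation identities\<close>

context group
begin

lemma inv_mult_cancel: "x \<in> carrier G \<Longrightarrow> y \<in> carrier G \<Longrightarrow> inv x \<otimes> (x \<otimes> y) = y"
  by (simp flip: m_assoc)

lemma mult_inv_cancel: "x \<in> carrier G \<Longrightarrow> y \<in> carrier G \<Longrightarrow> x \<otimes> (inv x \<otimes> y) = y"
  by (simp flip: m_assoc)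

lemmas group_word_simps = m_assoc inv_mult_group inv_mult_cancel mult_inv_cancel

lemma commutator_closed [simp]: "x \<in> carrier G \<Longrightarrow> y \<in> carrier G \<Longrightarrow> commutator G x y \<in> carrier G"
  by (simp add: commutator_def)

lemma conjugate_eq_commutator:
  "x \<in> carrier G \<Longrightarrow> y \<in> carrier G \<Longrightarrow> x \<otimes> y \<otimes> inv x = commutator G x y \<otimes> y"
  by (simp add: commutator_def group_word_simps)

text \<open>Replacing \<open>f\<close> by \<open>f p\<close> and \<open>g\<close> by
  \<open>g q\<close> changes the commutator by conjugates of commutators that each contain
  \<open>p\<close> or \<open>q\<close>. Derivatives of commutators and commutators in fibre products
  are both read off from this.\<close>

lemma commutator_mult_mult:
  assumes "f \<in> carrier G" "g \<in> carrier G" "p \<in> carrier G" "q \<in> carrier G"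
  shows "inv (commutator G f g) \<otimes> commutator G (f \<otimes> p) (g \<otimes> q) =
    ((g \<otimes> f \<otimes> inv g) \<otimes> (commutator G p g \<otimes> (g \<otimes> commutator G p q \<otimes> inv g)) \<otimes> inv (g \<otimes> f \<otimes> inv g))
      \<otimes> (g \<otimes> commutator G f q \<otimes> inv g)"
  using assms by (simp add: commutator_def group_word_simps)

end

lemma (in group) list_prod_single:
  assumes "distinct xs" "t \<in> set xs" "y t \<in> carrier G" "\<And>i. i \<in> set xs \<Longrightarrow> i \<noteq> t \<Longrightarrow> y i = \<one>"
  shows "list_prod G (map y xs) = y t"
proof -
  have one: "(\<And>i. i \<in> set xs \<Longrightarrow> y i = \<one>) \<Longrightarrow> list_prod G (map y xs) = \<one>" for xs
    by (induction xs) (auto simp: list_prod_def)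
  from assms show ?thesis
  proof (induction xs)
    case (Cons x xs)
    show ?case
    proof (cases "x = t")
      case True
      then have "list_prod G (map y xs) = \<one>" using Cons.prems by (intro one) auto
      with True Cons.prems show ?thesis by (simp add: list_prod_def)
    next
      case False
      with Cons show ?thesis by (simp add: list_prod_def)
    qed
  qed simp
qed

text \<open>The axioms cover both the given filtration and its \<open>fiber_level\<close>, whose
  level 0 is all of G x G while level 1 is the square group.\<close>

locale prefiltered_group = group G for G (structure) +
  fixes Hs :: "nat \<Rightarrow> 'a set" and l :: nat
  assumes subgroup_Hs: "subgroup (Hs i) G"
    and Hs_Suc: "Hs (Suc i) \<subseteq> Hs i"
    and commutator_Hs: "x \<in> Hs i \<Longrightarrow> y \<in> Hs j \<Longrightarrow> commutator G x y \<in> Hs (i + j)"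
begin

lemma Hs_antimono: "i \<le> j \<Longrightarrow> Hs j \<subseteq> Hs i"
  by (rule lift_Suc_antimono_le) (use Hs_Suc in auto)

lemma Hs_carrier: "x \<in> Hs i \<Longrightarrow> x \<in> carrier G"
  using subgroup.subset[OF subgroup_Hs] by blast

lemma Hs_one [simp]: "\<one> \<in> Hs i"
  by (rule subgroup.one_closed[OF subgroup_Hs])

lemma Hs_mult: "x \<in> Hs i \<Longrightarrow> y \<in> Hs i \<Longrightarrow> x \<otimes> y \<in> Hs i"
  by (rule subgroup.m_closed[OF subgroup_Hs])

lemma Hs_inv: "x \<in> Hs i \<Longrightarrow> inv x \<in> Hs i"
  by (rule subgroup.m_inv_closed[OF subgroup_Hs])

lemma Hs_int_pow: "x \<in> Hs i \<Longrightarrow> x [^] (m :: int) \<in> Hs i"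
  by (rule subgroup_int_pow_closed[OF subgroup_Hs])

lemma Hs_conjugate: "x \<in> Hs 0 \<Longrightarrow> y \<in> Hs i \<Longrightarrow> x \<otimes> y \<otimes> inv x \<in> Hs i"
  using commutator_Hs[of x 0 y i] by (simp add: conjugate_eq_commutator Hs_carrier Hs_mult)

text \<open>
  Closing the elementary sequences under commutators by fiat makes the filtered-group structure
  of these classes trivial; the content of the Lazard--Leibman theorem lies in \<open>pseq_derivative\<close>
  and \<open>pseq_taylor_expansion\<close>.
\<close>

inductive pseq :: "nat \<Rightarrow> (int list \<Rightarrow> 'a) \<Rightarrow> bool" where
  monomial: "x \<in> Hs (a + k) \<Longrightarrow> degree_le l k p \<Longrightarrow> pseq a (\<lambda>n. x [^] p n)"
| mult: "pseq a f \<Longrightarrow> pseq a g \<Longrightarrow> pseq a (\<lambda>n. f n \<otimes> g n)"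
| inverse: "pseq a f \<Longrightarrow> pseq a (\<lambda>n. inv (f n))"
| commut: "pseq a f \<Longrightarrow> pseq b g \<Longrightarrow> pseq (a + b) (\<lambda>n. commutator G (f n) (g n))"
| antimono: "pseq b f \<Longrightarrow> a \<le> b \<Longrightarrow> pseq a f"
| eq_on: "pseq a f \<Longrightarrow> (\<And>n. length n = l \<Longrightarrow> f n = g n) \<Longrightarrow> pseq a g"

lemma pseq_in_Hs: "pseq a f \<Longrightarrow> length n = l \<Longrightarrow> f n \<in> Hs a"
proof (induction rule: pseq.induct)
  case (monomial x a k p)
  then have "x \<in> Hs a" using Hs_antimono[of a "a + k"] by auto
  then show ?case by (rule Hs_int_pow)
next
  case (antimono b f a)
  then show ?case using Hs_antimono[of a b] by auto
qed (auto intro: Hs_mult Hs_inv commutator_Hs)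

lemma pseq_carrier: "pseq a f \<Longrightarrow> length n = l \<Longrightarrow> f n \<in> carrier G"
  by (rule Hs_carrier[OF pseq_in_Hs])

lemma pseq_const: "x \<in> Hs a \<Longrightarrow> pseq a (\<lambda>n. x)"
  using monomial[of x a 0 "\<lambda>n. 1"] by (simp add: Hs_carrier)

text \<open>The conjugate is a commutator of level \<open>0 + a\<close> times
  \<open>g\<close>.\<close>

lemma pseq_conjugate:
  assumes "pseq 0 f" "pseq a g" shows "pseq a (\<lambda>n. f n \<otimes> g n \<otimes> inv (f n))"
proof (rule pseq.eq_on)
  show "pseq a (\<lambda>n. commutator G (f n) (g n) \<otimes> g n)"
    using commut[OF assms] assms(2) by (auto intro: pseq.mult)
qed (use assms pseq_carrier in \<open>auto simp: conjugate_eq_commutator\<close>)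

text \<open>Induction over the generation of \<open>f\<close>. The gain of one level comes from the
  monomials: the exponent loses a degree while the base stays in \<open>Hs (a + k)\<close>. The
  group operations turn derivatives of their arguments into products of conjugates and commutators
  of these.\<close>

lemma pseq_derivative:
  assumes "pseq a f" and h: "length h = l"
  shows "pseq (Suc a) (\<lambda>n. inv (f n) \<otimes> f (vec_add n h))"
  using assms(1)
proof (induction rule: pseq.induct)
  case (monomial x a k p)
  have x: "x \<in> carrier G" using monomial(1) by (rule Hs_carrier)
  have "pseq (Suc a) (\<lambda>n. x [^] (p (vec_add n h) - p n))"
  \<comment> \<open>A constant exponent has no degree to lose, but its derivative is trivial and so
    lies at every level.\<close>
  proof (cases k)
    case 0
    with monomial(2) h show ?thesis
      by (intro pseq.eq_on[OF pseq_const[OF Hs_one]]) auto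
  next
    case (Suc k')
    with monomial h show ?thesis by (intro pseq.monomial[of _ _ k']) auto
  qed
  moreover have "x [^] (p (vec_add n h) - p n) = inv (x [^] p n) \<otimes> x [^] p (vec_add n h)" for n
    using x int_pow_mult[OF x, of "- p n" "p (vec_add n h)"] by (simp add: int_pow_neg)
  ultimately show ?case by simp
next
  case (mult a f g)
  let ?f = "\<lambda>n. inv (f n) \<otimes> f (vec_add n h)" and ?g = "\<lambda>n. inv (g n) \<otimes> g (vec_add n h)"
  have "pseq (Suc a) (\<lambda>n. inv (g n) \<otimes> ?f n \<otimes> inv (inv (g n)))"
    using mult by (intro pseq_conjugate pseq.inverse) (auto intro: pseq.antimono)
  then have "pseq (Suc a) (\<lambda>n. inv (g n) \<otimes> ?f n \<otimes> inv (inv (g n)) \<otimes> ?g n)"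
    by (rule pseq.mult[OF _ mult(4)])
  then show ?case
    by (rule pseq.eq_on)
      (use mult h in \<open>simp add: group_word_simps pseq_carrier[where f = f] pseq_carrier[where f = g]\<close>)
next
  case (inverse a f)
  let ?f = "\<lambda>n. inv (f n) \<otimes> f (vec_add n h)"
  have "pseq (Suc a) (\<lambda>n. f n \<otimes> inv (?f n) \<otimes> inv (f n))"
    using inverse by (intro pseq_conjugate pseq.inverse) (auto intro: pseq.antimono)
  then show ?case
    by (rule pseq.eq_on) (use inverse h in \<open>simp add: group_word_simps pseq_carrier[where f = f]\<close>)
next
  case (commut a f b g)
  \<comment> \<open>The shifted \<open>f\<close> is \<open>f n\<close> times \<open>?p n\<close>,
    and likewise for \<open>g\<close> and \<open>?q\<close>, so \<open>commutator_mult_mult\<close>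
    applies. The commutator of \<open>?p\<close> and \<open>?q\<close> even gains two
    levels.\<close>
  let ?p = "\<lambda>n. inv (f n) \<otimes> f (vec_add n h)" and ?q = "\<lambda>n. inv (g n) \<otimes> g (vec_add n h)"
  have 0: "pseq 0 f" "pseq 0 g"
    using commut by (auto intro: pseq.antimono)
  then have gfg: "pseq 0 (\<lambda>n. g n \<otimes> f n \<otimes> inv (g n))"
    by (intro pseq_conjugate)
  have pg: "pseq (Suc (a + b)) (\<lambda>n. commutator G (?p n) (g n))"
    using pseq.commut[OF commut(3) commut(2)] by simp
  have "pseq (Suc a + Suc b) (\<lambda>n. commutator G (?p n) (?q n))"
    by (rule pseq.commut[OF commut(3) commut(4)])
  then have pq: "pseq (Suc (a + b)) (\<lambda>n. commutator G (?p n) (?q n))"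
    by (rule pseq.antimono) simp
  have fq: "pseq (Suc (a + b)) (\<lambda>n. commutator G (f n) (?q n))"
    using pseq.commut[OF commut(1) commut(4)] by simp
  have "pseq (Suc (a + b)) (\<lambda>n.
    ((g n \<otimes> f n \<otimes> inv (g n)) \<otimes> (commutator G (?p n) (g n) \<otimes> (g n \<otimes> commutator G (?p n) (?q n) \<otimes> inv (g n)))
      \<otimes> inv (g n \<otimes> f n \<otimes> inv (g n))) \<otimes> (g n \<otimes> commutator G (f n) (?q n) \<otimes> inv (g n)))"
    by (intro pseq.mult pseq_conjugate pg pq fq 0 gfg)
  then show ?case
  proof (rule pseq.eq_on)
    fix n :: "int list" assume n: "length n = l"
    have c: "f n \<in> carrier G" "f (vec_add n h) \<in> carrier G"
      "g n \<in> carrier G" "g (vec_add n h) \<in> carrier G"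
      using commut(1,2) n h by (auto intro!: pseq_carrier)
    then show "((g n \<otimes> f n \<otimes> inv (g n)) \<otimes> (commutator G (?p n) (g n) \<otimes> (g n \<otimes> commutator G (?p n) (?q n) \<otimes> inv (g n)))
      \<otimes> inv (g n \<otimes> f n \<otimes> inv (g n))) \<otimes> (g n \<otimes> commutator G (f n) (?q n) \<otimes> inv (g n)) =
      inv (commutator G (f n) (g n)) \<otimes> commutator G (f (vec_add n h)) (g (vec_add n h))"
      by (subst commutator_mult_mult[symmetric]) (simp_all add: mult_inv_cancel)
  qed
next
  case (antimono b f a)
  from antimono(3) show ?case by (rule pseq.antimono) (use antimono in simp)
next
  case (eq_on a f g)
  from eq_on(3) show ?case by (rule pseq.eq_on) (use eq_on h in simp)
qed

lemma pseq_shift: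
  assumes "pseq a f" and h: "length h = l" shows "pseq a (\<lambda>n. f (vec_add n h))"
proof (rule pseq.eq_on)
  show "pseq a (\<lambda>n. f n \<otimes> (inv (f n) \<otimes> f (vec_add n h)))"
    by (intro pseq.mult assms pseq.antimono[OF pseq_derivative[OF assms]]) simp
qed (use assms in \<open>simp add: mult_inv_cancel pseq_carrier\<close>)

lemma pseq_list_prod:
  "(\<And>x. x \<in> set xs \<Longrightarrow> pseq a (\<lambda>n. F n x)) \<Longrightarrow> pseq a (\<lambda>n. list_prod G (map (F n) xs))"
proof (induction xs)
  case Nil
  then show ?case by (simp add: list_prod_def pseq_const)
next
  case (Cons x xs)
  have "pseq a (\<lambda>n. F n x \<otimes> list_prod G (map (F n) xs))"
    using Cons by (intro pseq.mult) auto
  then show ?case by (simp add: list_prod_def)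
qed

section \<open>Taylor expansion of polynomial sequences\<close>

lemma pseq_multi_binom:
  "x \<in> Hs (sum_list i) \<Longrightarrow> length i = l \<Longrightarrow> pseq 0 (\<lambda>n. x [^] multi_binom n i)"
  using monomial[of x 0 "sum_list i" "\<lambda>n. multi_binom n i"] by (simp add: degree_le_multi_binom)

text \<open>Each factor is a monomial at level 0, since \<open>multi_binom n i\<close> has degree at
  most \<open>sum_list i\<close>. \<open>pseq_taylor_expansion\<close> gives the converse for
  nilpotent levels.\<close>

lemma poly_seq_imp_pseq:
  assumes "poly_seq G Hs l f" shows "pseq 0 f"
proof -
  obtain s c where c: "\<And>i. i \<in> set (multi_indices_upto l s) \<Longrightarrow> c i \<in> Hs (sum_list i)"
    and f: "\<And>n. length n = l \<Longrightarrow>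
      f n = list_prod G (map (\<lambda>i. c i [^] multi_binom n i) (multi_indices_upto l s))"
    using assms unfolding poly_seq_def by blast
  have "pseq 0 (\<lambda>n. list_prod G (map (\<lambda>i. c i [^] multi_binom n i) (multi_indices_upto l s)))"
    using c by (intro pseq_list_prod pseq_multi_binom) (auto simp: set_multi_indices_upto)
  then show ?thesis by (rule pseq.eq_on) (simp add: f)
qed

text \<open>
  The hypothesis makes \<open>r\<close> at \<open>i\<close> equal to the iterated derivative of \<open>r\<close> at \<open>0\<close>,
  taken \<open>i ! t\<close> times in each unit direction \<open>t\<close>.
\<close>

lemma pseq_box_corner:
  assumes "pseq a r" "length i = l"
    and "\<And>j. list_all2 (\<le>) j i \<Longrightarrow> j \<noteq> i \<Longrightarrow> r (map int j) = \<one>"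
  shows "r (map int i) \<in> Hs (a + sum_list i)"
  using assms
proof (induction "sum_list i" arbitrary: a r i)
  case 0
  from 0(1) have "sum_list i = 0" by (rule sym)
  then show ?case using pseq_in_Hs[OF 0(2), of "map int i"] 0(3) by (simp del: sum_list_eq_0_iff)
next
  case (Suc k)
  then obtain t where t: "t < l" "i ! t > 0"
    by (metis gr0I in_set_conv_nth nat.distinct(1) sum_list_eq_0_iff)
  define i' where "i' = i[t := i ! t - 1]"
  have i': "length i' = l" "i'[t := Suc (i' ! t)] = i"
    using t Suc.prems(2) by (auto simp: i'_def)
  have sum: "sum_list i' = k"
    using t Suc.prems(2) Suc.hyps(2) member_le_sum_list[of "i ! t" i]
    by (auto simp: i'_def sum_list_update)
  let ?d = "\<lambda>n. inv (r n) \<otimes> r (vec_add n (unit_vec l t))"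
  have d: "?d (map int j) = inv (r (map int j)) \<otimes> r (map int (j[t := Suc (j ! t)]))"
    if "length j = l" for j
    using that t by (simp add: vec_add_unit_vec_map_int)
  \<comment> \<open>The box of \<open>i'\<close> is that of \<open>i\<close> without its top layer
    in direction \<open>t\<close>, so it misses \<open>i\<close> and \<open>r\<close> is trivial on
    it.\<close>
  have below: "r (map int j) = \<one>" if j: "list_all2 (\<le>) j i'" for j
  proof (rule Suc.prems(3))
    from j have *: "length j = l" "\<And>u. u < l \<Longrightarrow> j ! u \<le> i' ! u"
      using i' by (auto simp: list_all2_conv_all_nth)
    show "list_all2 (\<le>) j i"
      unfolding list_all2_conv_all_nth
    proof (intro conjI allI impI)
      fix u assume "u < length j"
      then show "j ! u \<le> i ! u"
        using * Suc.prems(2) t by (cases "u = t") (fastforce simp: i'_def)+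
    qed (use * Suc.prems in simp)
    show "j \<noteq> i"
      using *(2)[OF t(1)] t Suc.prems(2) by (auto simp: i'_def)
  qed
  \<comment> \<open>The level rises by one while the corner drops by one, so
    \<open>a + sum_list i\<close> is preserved. For \<open>j\<close> other than \<open>i'\<close>,
    both points of the difference lie in the box of \<open>i\<close> and avoid
    \<open>i\<close>.\<close>
  have "?d (map int i') \<in> Hs (Suc a + sum_list i')"
  proof (rule Suc.hyps(1))
    show "pseq (Suc a) ?d" by (intro pseq_derivative Suc.prems) simp
    fix j assume j: "list_all2 (\<le>) j i'" "j \<noteq> i'"
    then have len: "length j = l" using i' by (auto dest: list_all2_lengthD)
    have le: "list_all2 (\<le>) (j[t := Suc (j ! t)]) i"
      using list_all2_update_cong[OF j(1), of "Suc (j ! t)" "Suc (i' ! t)" t] i' j(1) t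
      by (auto simp: list_all2_conv_all_nth)
    have ne: "j[t := Suc (j ! t)] \<noteq> i"
    proof
      assume *: "j[t := Suc (j ! t)] = i"
      then have "i' = j[t := i ! t - 1]" by (auto simp: i'_def)
      also have "\<dots> = j" using * len t by (metis diff_Suc_1 list_update_id nth_list_update_eq)
      finally show False using j(2) by simp
    qed
    show "?d (map int j) = \<one>"
      unfolding d[OF len] using Suc.prems(3)[OF le ne] below[OF j(1)] by simp
  qed (use sum i' in auto)
  moreover have "r (map int i) \<in> carrier G"
    using Suc.prems by (intro pseq_carrier) auto
  moreover have "r (map int i') = \<one>"
    by (intro below) (simp add: list_all2_conv_all_nth)
  ultimately show ?case
    unfolding d[OF i'(1)] using i' sum by (simp flip: Suc.hyps(2))
qed

text \<open>Induction on \<open>m - a\<close>: unit derivatives have level \<open>Suc a\<close> and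
  lie in \<open>Hs m\<close> on a smaller simplex, so by induction everywhere. Hence a unit step
  does not change whether \<open>r n\<close> lies in \<open>Hs m\<close>, and the origin decides. It
  is applied with \<open>m = Suc s\<close> for the Taylor expansion and with \<open>m = 2\<close>
  for the linear part.\<close>

lemma pseq_in_Hs_from_simplex:
  assumes "pseq a r"
    and "\<And>j. length j = l \<Longrightarrow> sum_list j + a < m \<Longrightarrow> r (map int j) \<in> Hs m"
    and "length n = l"
  shows "r n \<in> Hs m"
  using assms
proof (induction "m - a" arbitrary: a r n)
  case 0
  then show ?case using pseq_in_Hs[of a r n] Hs_antimono[of m a] by auto
next
  case (Suc k)
  have d: "inv (r n) \<otimes> r (n[t := n ! t + 1]) \<in> Hs m" if "length n = l" "t < l" for n t
  proof -
    have "inv (r n) \<otimes> r (vec_add n (unit_vec l t)) \<in> Hs m"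
    proof (rule Suc.hyps(1)[of "Suc a" "\<lambda>n. inv (r n) \<otimes> r (vec_add n (unit_vec l t))"])
      fix j :: "nat list" assume j: "length j = l" "sum_list j + Suc a < m"
      have "sum_list (j[t := Suc (j ! t)]) = Suc (sum_list j)"
        using j(1) that by (simp add: sum_list_update member_le_sum_list)
      with j Suc.prems(2)[of j] Suc.prems(2)[of "j[t := Suc (j ! t)]"]
      show "inv (r (map int j)) \<otimes> r (vec_add (map int j) (unit_vec l t)) \<in> Hs m"
        using that by (auto simp: vec_add_unit_vec_map_int intro: Hs_mult Hs_inv)
    qed (use Suc.hyps(2) that in \<open>simp_all add: pseq_derivative[OF Suc.prems(1)]\<close>)
    then show ?thesis using that by (simp add: vec_add_unit_vec)
  qed
  show ?case
  proof (rule int_vec_coordinate_induct[where l = l and Q = "\<lambda>n. r n \<in> Hs m"])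
    \<comment> \<open>Here \<open>a < m\<close>, so the origin belongs to the simplex.\<close>
    show "r (replicate l 0) \<in> Hs m"
      using Suc.prems(2)[of "replicate l 0"] Suc.hyps(2) by (simp add: sum_list_replicate)
    fix n :: "int list" and t assume nt: "length n = l" "t < l"
    let ?n = "n[t := n ! t + 1]"
    have c: "r n \<in> carrier G" "r ?n \<in> carrier G"
      using nt by (auto intro!: pseq_carrier[OF Suc.prems(1)])
    show "r ?n \<in> Hs m \<longleftrightarrow> r n \<in> Hs m"
    proof
      assume "r ?n \<in> Hs m"
      from Hs_mult[OF this Hs_inv[OF d[OF nt]]] show "r n \<in> Hs m"
        using c by (simp add: group_word_simps)
    next
      assume "r n \<in> Hs m"
      from Hs_mult[OF this d[OF nt]] show "r ?n \<in> Hs m"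
        using c by (simp add: group_word_simps)
    qed
  qed (use Suc.prems in simp)
qed

lemma list_prod_closed: "set xs \<subseteq> carrier G \<Longrightarrow> list_prod G xs \<in> carrier G"
  by (induction xs) (auto simp: list_prod_def)

lemma list_prod_snoc:
  "set xs \<subseteq> carrier G \<Longrightarrow> x \<in> carrier G \<Longrightarrow> list_prod G (xs @ [x]) = list_prod G xs \<otimes> x"
proof (induction xs)
  case (Cons y xs)
  then show ?case using list_prod_closed[of xs] by (simp add: list_prod_def m_assoc)
qed (simp add: list_prod_def)

text \<open>
  In the order of the multi-indices each index comes after everything below it in its box, so the
  Taylor coefficients can be chosen one after the other to make the product agree with \<open>f\<close>.
\<close>

lemma pseq_interpolation:
  assumes f: "pseq 0 f" and "multi_indices_upto l s = ys @ zs"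
  shows "\<exists>c. (\<forall>i\<in>set ys. c i \<in> Hs (sum_list i)) \<and>
    (\<forall>j\<in>set ys. list_prod G (map (\<lambda>i. c i [^] multi_binom (map int j) i) ys) = f (map int j))"
  using assms(2)
proof (induction ys arbitrary: zs rule: rev_induct)
  case (snoc i ys)
  obtain c where c: "\<And>i. i \<in> set ys \<Longrightarrow> c i \<in> Hs (sum_list i)"
    and cf: "\<And>j. j \<in> set ys \<Longrightarrow>
      list_prod G (map (\<lambda>i. c i [^] multi_binom (map int j) i) ys) = f (map int j)"
    using snoc.IH[of "i # zs"] snoc.prems by auto
  have idx: "j \<in> set (ys @ i # zs) \<longleftrightarrow> length j = l \<and> sum_list j \<le> s" for j
    using set_multi_indices_upto[of l s] snoc.prems by simp
  have len: "length i = l" "sum_list i \<le> s" "\<And>j. j \<in> set ys \<Longrightarrow> length j = l"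
    using idx[of i] idx by auto
  have sorted: "sorted_wrt (\<lambda>a b. \<not> list_all2 (\<le>) b a) (ys @ i # zs)"
    using sorted_wrt_multi_indices_upto[of l s] snoc.prems by simp
  \<comment> \<open>Everything below \<open>i\<close> lies in the simplex too, hence in the
    enumeration, and the order places it before \<open>i\<close>.\<close>
  have below: "j \<in> set ys" if "list_all2 (\<le>) j i" "j \<noteq> i" for j
  proof -
    have "length j = l" using that len by (auto dest: list_all2_lengthD)
    moreover have "sum_list j \<le> sum_list i"
      using that(1) by (induction rule: list_all2_induct) auto
    ultimately have "j \<in> set (ys @ i # zs)" unfolding idx using len(2) by simp
    with sorted that show ?thesis by (auto simp: sorted_wrt_append)
  qed
  have above: "\<not> list_all2 (\<le>) i j" if "j \<in> set ys" for j
    using sorted that by (auto simp: sorted_wrt_append)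
  then have "i \<notin> set ys"
    by (metis list.rel_refl order_refl)
  define T where "T n = list_prod G (map (\<lambda>i. c i [^] multi_binom n i) ys)" for n
  have T: "pseq 0 T"
    unfolding T_def using c len by (intro pseq_list_prod pseq_multi_binom) auto
  define r where "r n = inv (T n) \<otimes> f n" for n
  have r: "pseq 0 r"
    unfolding r_def by (intro pseq.mult pseq.inverse T f)
  have fc: "f (map int j) \<in> carrier G" if "length j = l" for j :: "nat list"
    using that by (intro pseq_carrier[OF f]) simp
  have "r (map int j) = \<one>" if "j \<in> set ys" for j
    using that fc len(3) by (simp add: r_def T_def cf)
  with pseq_box_corner[OF r len(1)] below have ri: "r (map int i) \<in> Hs (sum_list i)"
    by simp
  \<comment> \<open>The new coefficient is the residual at \<open>i\<close>: its binomial is 1 there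
    and vanishes at the earlier nodes.\<close>
  define c' where "c' = c(i := r (map int i))"
  have c': "c' k \<in> Hs (sum_list k)" if "k \<in> set (ys @ [i])" for k
    using that c ri by (auto simp: c'_def)
  have prod: "list_prod G (map (\<lambda>i. c' i [^] multi_binom n i) (ys @ [i]))
      = T n \<otimes> r (map int i) [^] multi_binom n i" for n
  proof -
    have eq: "map (\<lambda>i. c' i [^] multi_binom n i) (ys @ [i]) =
        map (\<lambda>i. c i [^] multi_binom n i) ys @ [r (map int i) [^] multi_binom n i]"
      using \<open>i \<notin> set ys\<close> by (auto simp: c'_def)
    show ?thesis
      unfolding eq T_def using Hs_carrier[OF c] Hs_carrier[OF ri]
      by (intro list_prod_snoc) auto
  qed
  have "list_prod G (map (\<lambda>i. c' i [^] multi_binom (map int j) i) (ys @ [i])) = f (map int j)"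
    if j: "j \<in> set (ys @ [i])" for j
  proof (cases "j = i")
    case True
    have "T (map int i) \<in> carrier G" "f (map int i) \<in> carrier G"
      using len by (auto intro!: pseq_carrier[OF T] fc)
    then show ?thesis
      unfolding prod using True Hs_carrier[OF ri]
      by (simp add: multi_binom_self r_def mult_inv_cancel)
  next
    case False
    with j have "j \<in> set ys" by simp
    then show ?thesis
      unfolding prod using len multi_binom_eq_0[of i j] above cf fc by (simp add: T_def)
  qed
  with c' show ?case by blast
qed simp

lemma pseq_taylor_expansion:
  assumes f: "pseq 0 f" and nilpotent: "Hs (Suc s) = {\<one>}"
  shows "\<exists>c. (\<forall>i\<in>set (multi_indices_upto l s). c i \<in> Hs (sum_list i)) \<and>
    (\<forall>n. length n = l \<longrightarrow>
      f n = list_prod G (map (\<lambda>i. c i [^] multi_binom n i) (multi_indices_upto l s)))"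
proof -
  let ?T = "\<lambda>c n. list_prod G (map (\<lambda>i. c i [^] multi_binom n i) (multi_indices_upto l s))"
  obtain c where c: "\<And>i. i \<in> set (multi_indices_upto l s) \<Longrightarrow> c i \<in> Hs (sum_list i)"
    and cf: "\<And>j. j \<in> set (multi_indices_upto l s) \<Longrightarrow> ?T c (map int j) = f (map int j)"
    using pseq_interpolation[OF f, of s "multi_indices_upto l s" "[]"] by auto
  have T: "pseq 0 (?T c)"
    using c by (intro pseq_list_prod pseq_multi_binom) (auto simp: set_multi_indices_upto)
  have "f n = ?T c n" if n: "length n = l" for n
  proof -
    \<comment> \<open>The quotient is trivial on the simplex \<open>sum_list j <= s\<close>, which
      forces it into \<open>Hs (Suc s)\<close> everywhere.\<close>
    have "inv (?T c n) \<otimes> f n \<in> Hs (Suc s)"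
    proof (rule pseq_in_Hs_from_simplex[OF pseq.mult[OF pseq.inverse[OF T] f] _ n])
      fix j :: "nat list" assume "length j = l" "sum_list j + 0 < Suc s"
      then show "inv (?T c (map int j)) \<otimes> f (map int j) \<in> Hs (Suc s)"
        using pseq_carrier[OF f, of "map int j"] by (simp add: cf set_multi_indices_upto)
    qed
    then have "inv (?T c n) \<otimes> f n = \<one>" using nilpotent by simp
    then show ?thesis
      using pseq_carrier[OF T n] pseq_carrier[OF f n]
      by (metis inv_closed inv_inv inv_equality)
  qed
  with c show ?thesis by blast
qed

end

section \<open>Fibre products\<close>

lemma (in group) group_DirProd_self: "group (G \<times>\<times> G)"
  by (rule DirProd_group[OF is_group is_group])

lemma (in group) inv_DirProd_self:
  "x \<in> carrier G \<Longrightarrow> y \<in> carrier G \<Longrightarrow> inv\<^bsub>G \<times>\<times> G\<^esub> (x, y) = (inv x, inv y)"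
  by (rule inv_DirProd[OF is_group is_group])

lemma (in group) int_pow_DirProd_self:
  assumes "x \<in> carrier G" "y \<in> carrier G"
  shows "(x, y) [^]\<^bsub>G \<times>\<times> G\<^esub> (m :: int) = (x [^] m, y [^] m)"
proof -
  have nat: "(x, y) [^]\<^bsub>G \<times>\<times> G\<^esub> (k :: nat) = (x [^] k, y [^] k)" for k
    by (induction k) auto
  show ?thesis
    unfolding int_pow_def2 nat by (simp only: inv_DirProd_self nat_pow_closed assms split: if_split) blast
qed

lemma (in group) commutator_DirProd_self:
  "x \<in> carrier G \<Longrightarrow> y \<in> carrier G \<Longrightarrow> x' \<in> carrier G \<Longrightarrow> y' \<in> carrier G \<Longrightarrow>
    commutator (G \<times>\<times> G) (x, y) (x', y') = (commutator G x x', commutator G y y')"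
  by (simp add: commutator_def inv_DirProd_self)

context prefiltered_group
begin

text \<open>The formula is uniform in \<open>i\<close>, so that pairing an element of
  \<open>Hs (Suc i)\<close> with 1 lands in level \<open>i\<close> for \<open>i = 0\<close> as well;
  \<open>pseq_fst\<close> relies on this.\<close>

definition fiber_level :: "nat \<Rightarrow> ('a \<times> 'a) set" where
  "fiber_level i = fiber_prod G (Hs i) (Hs (Suc i))"

text \<open>Normality moves the quotient \<open>y x^-1\<close> of the definition to the right of
  \<open>x\<close>. Pairs written as \<open>(x, x p)\<close> fit
  \<open>commutator_mult_mult\<close>.\<close>

lemma fiber_level_iff: "(x, y) \<in> fiber_level i \<longleftrightarrow> x \<in> Hs i \<and> (\<exists>p\<in>Hs (Suc i). y = x \<otimes> p)"
proof
  assume "(x, y) \<in> fiber_level i"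
  then have *: "x \<in> Hs i" "y \<in> Hs i" "y \<otimes> inv x \<in> Hs (Suc i)"
    by (auto simp: fiber_level_def fiber_prod_def)
  then have "inv x \<in> Hs 0" using Hs_antimono[of 0 i] by (auto intro: Hs_inv)
  from Hs_conjugate[OF this *(3)] have "inv x \<otimes> y \<in> Hs (Suc i)"
    using * by (simp add: group_word_simps Hs_carrier)
  moreover have "y = x \<otimes> (inv x \<otimes> y)"
    using * by (simp add: mult_inv_cancel Hs_carrier)
  ultimately show "x \<in> Hs i \<and> (\<exists>p\<in>Hs (Suc i). y = x \<otimes> p)" using * by blast
next
  assume "x \<in> Hs i \<and> (\<exists>p\<in>Hs (Suc i). y = x \<otimes> p)"
  then obtain p where *: "x \<in> Hs i" "p \<in> Hs (Suc i)" "y = x \<otimes> p" by blast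
  then have "x \<otimes> p \<otimes> inv x \<in> Hs (Suc i)"
    using Hs_antimono[of 0 i] by (intro Hs_conjugate) auto
  then show "(x, y) \<in> fiber_level i"
    using * Hs_Suc[of i] by (auto simp: fiber_level_def fiber_prod_def intro: Hs_mult)
qed

lemma Hs_conjugate': "x \<in> Hs i \<Longrightarrow> y \<in> Hs j \<Longrightarrow> x \<otimes> y \<otimes> inv x \<in> Hs j"
  using Hs_antimono[of 0 i] by (intro Hs_conjugate) auto

text \<open>With pairs written as \<open>(x, x p)\<close>, each group operation changes the second
  component, relative to the first, by an element of the next level.\<close>

lemma prefiltered_group_fiber_level: "prefiltered_group (G \<times>\<times> G) fiber_level"
proof -
  interpret sq: group "G \<times>\<times> G" by (rule group_DirProd_self)
  show ?thesis
  proof (intro prefiltered_group.intro prefiltered_group_axioms.intro)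
    show "group (G \<times>\<times> G)" by (rule group_DirProd_self)
  next
    fix i
    show "subgroup (fiber_level i) (G \<times>\<times> G)"
    proof (rule sq.subgroupI)
      show "fiber_level i \<subseteq> carrier (G \<times>\<times> G)"
        by (auto simp: fiber_level_def fiber_prod_def Hs_carrier)
      have "(\<one>, \<one>) \<in> fiber_level i" by (auto simp: fiber_level_iff intro!: bexI[of _ \<one>])
      then show "fiber_level i \<noteq> {}" by blast
    next
      fix u assume "u \<in> fiber_level i"
      then obtain x p where u: "u = (x, x \<otimes> p)" "x \<in> Hs i" "p \<in> Hs (Suc i)"
        by (cases u) (auto simp: fiber_level_iff)
      then have "inv (x \<otimes> p) = inv x \<otimes> (x \<otimes> inv p \<otimes> inv x)"
        by (simp add: group_word_simps Hs_carrier)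
      with u show "inv\<^bsub>G \<times>\<times> G\<^esub> u \<in> fiber_level i"
        by (auto simp: inv_DirProd_self Hs_carrier fiber_level_iff Hs_inv
            intro!: bexI[of _ "x \<otimes> inv p \<otimes> inv x"] Hs_conjugate'[of x i])
    next
      fix u v assume "u \<in> fiber_level i" "v \<in> fiber_level i"
      then obtain x p y q where u: "u = (x, x \<otimes> p)" "x \<in> Hs i" "p \<in> Hs (Suc i)"
        and v: "v = (y, y \<otimes> q)" "y \<in> Hs i" "q \<in> Hs (Suc i)"
        by (cases u; cases v) (auto simp: fiber_level_iff)
      have "inv y \<otimes> p \<otimes> inv (inv y) \<in> Hs (Suc i)"
        using u v by (intro Hs_conjugate'[of _ i] Hs_inv)
      then have "inv y \<otimes> p \<otimes> y \<otimes> q \<in> Hs (Suc i)"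
        using v by (auto simp: Hs_carrier intro: Hs_mult)
      moreover have "x \<otimes> p \<otimes> (y \<otimes> q) = (x \<otimes> y) \<otimes> (inv y \<otimes> p \<otimes> y \<otimes> q)"
        using u v by (simp add: group_word_simps Hs_carrier)
      ultimately show "u \<otimes>\<^bsub>G \<times>\<times> G\<^esub> v \<in> fiber_level i"
        using u v by (auto simp: fiber_level_iff intro: Hs_mult)
    qed
  next
    fix i show "fiber_level (Suc i) \<subseteq> fiber_level i"
      using Hs_Suc[of i] Hs_Suc[of "Suc i"] by (auto simp: fiber_level_def fiber_prod_def)
  next
    fix u v i j assume "u \<in> fiber_level i" "v \<in> fiber_level j"
    then obtain x p y q where u: "u = (x, x \<otimes> p)" "x \<in> Hs i" "p \<in> Hs (Suc i)"
      and v: "v = (y, y \<otimes> q)" "y \<in> Hs j" "q \<in> Hs (Suc j)"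
      by (cases u; cases v) (auto simp: fiber_level_iff)
    note car = u(2,3)[THEN Hs_carrier] v(2,3)[THEN Hs_carrier]
    have pg: "commutator G p y \<in> Hs (Suc (i + j))" and fq: "commutator G x q \<in> Hs (Suc (i + j))"
      using commutator_Hs[OF u(3) v(2)] commutator_Hs[OF u(2) v(3)] by simp_all
    have pq: "commutator G p q \<in> Hs (Suc (i + j))"
      using commutator_Hs[OF u(3) v(3)] Hs_Suc[of "Suc (i + j)"] by auto
    have yxy: "y \<otimes> x \<otimes> inv y \<in> Hs i"
      by (rule Hs_conjugate'[OF v(2) u(2)])
    have "inv (commutator G x y) \<otimes> commutator G (x \<otimes> p) (y \<otimes> q) \<in> Hs (Suc (i + j))"
      unfolding commutator_mult_mult[OF car(1,3,2,4)]
      by (intro Hs_mult Hs_conjugate'[OF yxy] Hs_conjugate'[OF v(2)] pg pq fq)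
    moreover have "commutator G (x \<otimes> p) (y \<otimes> q) =
        commutator G x y \<otimes> (inv (commutator G x y) \<otimes> commutator G (x \<otimes> p) (y \<otimes> q))"
      using car by (simp add: mult_inv_cancel)
    ultimately have "(commutator G x y, commutator G (x \<otimes> p) (y \<otimes> q)) \<in> fiber_level (i + j)"
      unfolding fiber_level_iff using commutator_Hs[OF u(2) v(2)] by blast
    then show "commutator (G \<times>\<times> G) u v \<in> fiber_level (i + j)"
      using u v car by (simp add: commutator_DirProd_self)
  qed
qed

interpretation sq: prefiltered_group "G \<times>\<times> G" fiber_level l
  by (rule prefiltered_group_fiber_level)

lemma pseq_diagonal: "pseq a f \<Longrightarrow> sq.pseq a (\<lambda>n. (f n, f n))"
proof (induction rule: pseq.induct)
  case (monomial x a k p)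
  have "(x, x) \<in> fiber_level (a + k)"
    using monomial(1) by (auto simp: fiber_level_iff Hs_carrier intro!: bexI[of _ \<one>])
  from sq.pseq.monomial[OF this monomial(2)] show ?case
    using Hs_carrier[OF monomial(1)] by (simp add: int_pow_DirProd_self)
next
  case (mult a f g)
  from sq.pseq.mult[OF mult(3,4)] show ?case by simp
next
  case (inverse a f)
  from sq.pseq.inverse[OF inverse(2)] show ?case
    by (rule sq.pseq.eq_on) (simp add: inv_DirProd_self pseq_carrier[OF inverse(1)])
next
  case (commut a f b g)
  from sq.pseq.commut[OF commut(3,4)] show ?case
    by (rule sq.pseq.eq_on)
      (simp add: commutator_DirProd_self pseq_carrier[OF commut(1)] pseq_carrier[OF commut(2)])
next
  case (antimono b f a)
  from antimono(3,2) show ?case by (rule sq.pseq.antimono)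
next
  case (eq_on a f g)
  from eq_on(3) show ?case by (rule sq.pseq.eq_on) (simp add: eq_on(2))
qed

text \<open>One level is lost because \<open>(x, 1)\<close> lies in \<open>fiber_level i\<close>
  exactly when \<open>x\<close> lies in \<open>Hs (Suc i)\<close>.\<close>

lemma pseq_fst: "pseq a f \<Longrightarrow> a > 0 \<Longrightarrow> sq.pseq (a - 1) (\<lambda>n. (f n, \<one>))"
proof (induction rule: pseq.induct)
  case (monomial x a k p)
  have x: "x \<in> Hs (a + k)" "x \<in> carrier G" using monomial(1) Hs_carrier by auto
  with monomial(3) Hs_Suc[of "a - 1 + k"] have "(x, \<one>) \<in> fiber_level (a - 1 + k)"
    by (auto simp: fiber_level_iff intro!: bexI[of _ "inv x"] Hs_inv)
  from sq.pseq.monomial[OF this monomial(2)] show ?case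
    using x by (simp add: int_pow_DirProd_self)
next
  case (mult a f g)
  from sq.pseq.mult[OF mult(3,4)[OF mult(5)]] show ?case by simp
next
  case (inverse a f)
  from sq.pseq.inverse[OF inverse(2)[OF inverse(3)]] show ?case
    by (rule sq.pseq.eq_on) (simp add: inv_DirProd_self pseq_carrier[OF inverse(1)])
next
  case (commut a f b g)
  have c: "f n \<in> carrier G" "g n \<in> carrier G" if "length n = l" for n
    using pseq_carrier[OF commut(1) that] pseq_carrier[OF commut(2) that] by auto
  show ?case
  \<comment> \<open>Pairing both arguments with 1 would lose two levels. Using the diagonal copy of
    one of them gives the same commutator and loses only one.\<close>
  proof (cases "a > 0")
    case True
    have "sq.pseq (a - 1 + b) (\<lambda>n. commutator (G \<times>\<times> G) (f n, \<one>) (g n, g n))"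
      by (rule sq.pseq.commut[OF commut(3)[OF True] pseq_diagonal[OF commut(2)]])
    then have "sq.pseq (a - 1 + b) (\<lambda>n. (commutator G (f n) (g n), \<one>))"
      by (rule sq.pseq.eq_on) (simp add: c commutator_DirProd_self, simp add: c commutator_def)
    with True show ?thesis by simp
  next
    case False
    then have "b > 0" using commut(5) by simp
    have "sq.pseq (a + (b - 1)) (\<lambda>n. commutator (G \<times>\<times> G) (f n, f n) (g n, \<one>))"
      by (rule sq.pseq.commut[OF pseq_diagonal[OF commut(1)] commut(4)[OF \<open>b > 0\<close>]])
    then have "sq.pseq (a + (b - 1)) (\<lambda>n. (commutator G (f n) (g n), \<one>))"
      by (rule sq.pseq.eq_on) (simp add: c commutator_DirProd_self, simp add: c commutator_def)
    with False show ?thesis by simp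
  qed
next
  case (antimono b f a)
  have "sq.pseq (b - 1) (\<lambda>n. (f n, \<one>))" using antimono by simp
  then show ?case by (rule sq.pseq.antimono) (use antimono in simp)
next
  case (eq_on a f g)
  from eq_on(3)[OF eq_on(4)] show ?case by (rule sq.pseq.eq_on) (simp add: eq_on(2))
qed

section \<open>The linear part of a polynomial sequence\<close>

lemma pseq_g_lin:
  assumes "\<And>j. j < l \<Longrightarrow> g (unit_vec l j) \<in> Hs 1"
  shows "pseq 0 (g_lin G l g)"
  unfolding g_lin_def
proof (rule pseq_list_prod)
  fix j assume "j \<in> set [0..<l]"
  then show "pseq 0 (\<lambda>n. g (unit_vec l j) [^] n ! j)"
    using monomial[of "g (unit_vec l j)" 0 1 "\<lambda>n. n ! j"] degree_le_linear[of j l 0] assms by simp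
qed

lemma g_lin_zero: "g_lin G l g (replicate l 0) = \<one>"
proof -
  have "list_prod G (map (\<lambda>j. \<one>) xs) = \<one>" for xs :: "nat list"
    by (induction xs) (auto simp: list_prod_def)
  moreover have "map (\<lambda>j. g (unit_vec l j) [^] (replicate l 0 ! j :: int)) [0..<l] = map (\<lambda>j. \<one>) [0..<l]"
    by auto
  ultimately show ?thesis unfolding g_lin_def by metis
qed

lemma g_lin_unit_vec:
  assumes "t < l" "g (unit_vec l t) \<in> carrier G"
  shows "g_lin G l g (unit_vec l t) = g (unit_vec l t)"
proof -
  have "list_prod G (map (\<lambda>j. g (unit_vec l j) [^] unit_vec l t ! j) [0..<l]) =
      g (unit_vec l t) [^] unit_vec l t ! t"
    using assms by (intro list_prod_single) (auto simp: unit_vec_def)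
  then show ?thesis using assms unfolding g_lin_def by (simp add: unit_vec_def)
qed

end

text \<open>For \<open>m = 2\<close> and level 0, the simplex of
  \<open>pseq_in_Hs_from_simplex\<close> consists of the origin and the unit vectors, where
  \<open>g\<close> and \<open>g_lin\<close> agree.\<close>

lemma sum_list_less_2_cases:
  fixes j :: "nat list"
  assumes "length j = l" "sum_list j < 2"
  obtains "map int j = replicate l 0" | t where "t < l" "map int j = unit_vec l t"
proof (cases "\<exists>t<l. j ! t \<noteq> 0")
  case True
  then obtain t where t: "t < l" "j ! t \<noteq> 0" by blast
  have le: "u < l \<Longrightarrow> sum_list (j[t := 0]) \<ge> j[t := 0] ! u" for u
    using assms(1) by (intro elem_le_sum_list) simp
  have "sum_list (j[t := 0]) = sum_list j - j ! t"
    using t assms(1) by (simp add: sum_list_update)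
  moreover have "j ! t \<le> sum_list j"
    using t assms(1) by (intro elem_le_sum_list) simp
  ultimately have "sum_list (j[t := 0]) = 0" and jt: "j ! t = 1"
    using t(2) assms(2) by auto
  then have "u < l \<Longrightarrow> u \<noteq> t \<Longrightarrow> j ! u = 0" for u
    using le[of u] assms(1) by (simp del: sum_list_eq_0_iff)
  with jt t assms(1) have "map int j = unit_vec l t"
    by (intro nth_equalityI) (auto simp: unit_vec_def)
  with t that show ?thesis by blast
next
  case False
  then have "map int j = replicate l 0"
    using assms(1) by (intro nth_equalityI) auto
  with that show ?thesis by blast
qed

text \<open>By \<open>Hs 1 = Hs 0\<close> the values of \<open>g\<close> at unit vectors have level
  1, as exponents of degree 1 require; the rest is agreement on the simplex for
  \<open>m = 2\<close>.\<close>

lemma (in prefiltered_group) g_lin_congruent: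
  assumes g: "pseq 0 g" and Hs1: "Hs 1 = Hs 0" and g0: "g (replicate l 0) = \<one>" and n: "length n = l"
  shows "inv (g_lin G l g n) \<otimes> g n \<in> Hs 2"
proof (rule pseq_in_Hs_from_simplex[OF _ _ n])
  have gu: "g (unit_vec l j) \<in> Hs 1" for j
    unfolding Hs1 by (rule pseq_in_Hs[OF g]) simp
  then show "pseq 0 (\<lambda>n. inv (g_lin G l g n) \<otimes> g n)"
    by (intro pseq.mult pseq.inverse pseq_g_lin g)
  fix j :: "nat list" assume j: "length j = l" "sum_list j + 0 < 2"
  then have "sum_list j < 2" by simp
  from j(1) this have "g_lin G l g (map int j) = g (map int j)"
    by (rule sum_list_less_2_cases) (simp_all add: g0 g_lin_zero g_lin_unit_vec Hs_carrier[OF gu])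
  then show "inv (g_lin G l g (map int j)) \<otimes> g (map int j) \<in> Hs 2"
    using pseq_carrier[OF g, of "map int j"] j by simp
qed

section \<open>From fibre levels to the square group\<close>

lemma distinct_multi_indices_upto: "distinct (multi_indices_upto l s)"
proof -
  have "sorted_wrt (\<lambda>a b. \<not> list_all2 (\<le>) b a) xs \<Longrightarrow> distinct xs" for xs :: "nat list list"
    by (induction xs) (auto simp: list_all2_refl)
  then show ?thesis using sorted_wrt_multi_indices_upto by blast
qed

text \<open>
  On \<open>G \<times> G\<close> the levels of fibre products start with the whole group at index 0, one step larger
  than the filtration of the square group; the two differ only in what they require of the
  constant Taylor coefficient, which is the value at 0.
\<close>

lemma poly_seq_square_group:
  assumes pre: "prefiltered_group G Gs" and Gs1: "Gs 1 = carrier G" and nilpotent: "\<forall>i\<ge>s. Gs i = {\<one>\<^bsub>G\<^esub>}"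
    and F: "prefiltered_group.pseq (G \<times>\<times> G) (prefiltered_group.fiber_level G Gs) l 0 F"
    and F0: "F (replicate l 0) \<in> fiber_prod G (carrier G) (Gs 2)"
  shows "poly_seq (square_group G Gs) (square_filtration G Gs) l F"
proof -
  interpret prefiltered_group G Gs l by (rule pre)
  interpret sq: prefiltered_group "G \<times>\<times> G" fiber_level l
    by (rule prefiltered_group_fiber_level)
  let ?I = "multi_indices_upto l s" and ?C = "fiber_prod G (carrier G) (Gs 2)"
  have C: "?C = fiber_level 1"
    using Gs1 by (simp add: fiber_level_def numeral_2_eq_2)
  have level: "square_filtration G Gs i = (if i = 0 then ?C else fiber_level i)" for i
    by (simp add: square_filtration_def fiber_level_def)
  have "fiber_level (Suc s) = {\<one>\<^bsub>G \<times>\<times> G\<^esub>}"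
    using nilpotent by (auto simp: fiber_level_iff)
  then obtain c where c: "\<And>i. i \<in> set ?I \<Longrightarrow> c i \<in> fiber_level (sum_list i)"
    and Fc: "\<And>n. length n = l \<Longrightarrow>
      F n = list_prod (G \<times>\<times> G) (map (\<lambda>i. c i [^]\<^bsub>G \<times>\<times> G\<^esub> multi_binom n i) ?I)"
    using sq.pseq_taylor_expansion[OF F, of s] by blast
  let ?z = "replicate l 0 :: nat list"
  have I0: "?z \<in> set ?I" by (simp add: set_multi_indices_upto sum_list_replicate)
  have b0: "multi_binom (replicate l 0) ?z = 1"
    using multi_binom_self[of ?z] by simp
  \<comment> \<open>At the origin every binomial except that of the zero index vanishes, so the
    constant coefficient is the value of \<open>F\<close> there.\<close>
  have "F (replicate l 0) = c ?z [^]\<^bsub>G \<times>\<times> G\<^esub> multi_binom (replicate l 0) ?z"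
    unfolding Fc[OF length_replicate]
  proof (rule sq.list_prod_single[OF distinct_multi_indices_upto I0])
    show "c ?z [^]\<^bsub>G \<times>\<times> G\<^esub> multi_binom (replicate l 0) ?z \<in> carrier (G \<times>\<times> G)"
      by (rule sq.int_pow_closed[OF sq.Hs_carrier[OF c[OF I0]]])
    fix i assume "i \<in> set ?I" "i \<noteq> ?z"
    then show "c i [^]\<^bsub>G \<times>\<times> G\<^esub> multi_binom (replicate l 0) i = \<one>\<^bsub>G \<times>\<times> G\<^esub>"
      using multi_binom_0[of i l] by (simp add: set_multi_indices_upto del: one_DirProd)
  qed
  then have c0: "c ?z \<in> ?C"
    using F0 sq.int_pow_1[OF sq.Hs_carrier[OF c[OF I0]]] by (simp only: b0)
  have c': "c i \<in> square_filtration G Gs (sum_list i)" if "i \<in> set ?I" for i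
  proof (cases "sum_list i = 0")
    case True
    then have "i = ?z"
      using that by (simp add: set_multi_indices_upto) (metis replicate_eqI)
    with c0 show ?thesis by (simp add: level sum_list_replicate)
  next
    case False
    with c[OF that] show ?thesis by (simp add: level del: sum_list_eq_0_iff)
  qed
  have cC: "c i \<in> ?C" if "i \<in> set ?I" for i
    using c'[OF that] sq.Hs_antimono[of 1 "sum_list i"]
    by (cases "sum_list i = 0") (auto simp: level C simp del: sum_list_eq_0_iff)
  have "F n = list_prod (square_group G Gs)
      (map (\<lambda>i. c i [^]\<^bsub>square_group G Gs\<^esub> multi_binom n i) ?I)" if "length n = l" for n
  proof -
    \<comment> \<open>Inverses, and with them integer powers, depend on the carrier; they agree
      because the coefficients lie in the subgroup.\<close>
    have "c i [^]\<^bsub>square_group G Gs\<^esub> m = c i [^]\<^bsub>G \<times>\<times> G\<^esub> m" if "i \<in> set ?I" for i and m :: int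
      unfolding square_group_def using cC[OF that] sq.subgroup_Hs[of 1]
      by (subst sq.int_pow_consistent) (simp_all add: C)
    then have "map (\<lambda>i. c i [^]\<^bsub>square_group G Gs\<^esub> multi_binom n i) ?I =
        map (\<lambda>i. c i [^]\<^bsub>G \<times>\<times> G\<^esub> multi_binom n i) ?I"
      by simp
    moreover have "list_prod (square_group G Gs) xs = list_prod (G \<times>\<times> G) xs" for xs
      by (simp add: list_prod_def square_group_def)
    ultimately show ?thesis using Fc[OF that] by (simp only:)
  qed
  with c' show ?thesis unfolding poly_seq_def by blast
qed

section \<open>The sequence attached to the shift by h\<close>

lemma filtration_imp_prefiltered_group: "group G \<Longrightarrow> filtration G Gs \<Longrightarrow> prefiltered_group G Gs"
  by (auto simp: filtration_def prefiltered_group_def prefiltered_group_axioms_def commutator_def)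

lemma frac_part_closed:
  assumes "unique_frac_factorization G \<Gamma> \<psi> d" "x \<in> carrier G"
  shows "frac_part G \<Gamma> \<psi> d x \<in> carrier G"
proof -
  have "\<exists>!y. y \<in> carrier G \<and> in_fund_box d (\<psi> y) \<and> inv\<^bsub>G\<^esub> y \<otimes>\<^bsub>G\<^esub> x \<in> \<Gamma>"
    using assms unfolding unique_frac_factorization_def by blast
  from theI'[OF this] show ?thesis unfolding frac_part_def by blast
qed

theorem lemmal:
  fixes G :: "('a, 'b) monoid_scheme"
    and Gs :: "nat \<Rightarrow> 'a set"
    and \<Gamma> :: "'a set"
    and \<psi> :: "'a \<Rightarrow> nat \<Rightarrow> real"
    and d l :: nat
    and g :: "int list \<Rightarrow> 'a"
    and h :: "int list"
  assumes "group G"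
    and "filtration G Gs"
    and "subgroup \<Gamma> G"
    and "unique_frac_factorization G \<Gamma> \<psi> d"
    and "poly_seq G Gs l g"
    and "g (replicate l 0) = \<one>\<^bsub>G\<^esub>"
    and "length h = l"
  shows "poly_seq (square_group G Gs) (square_filtration G Gs) l
           (\<lambda>n. (inv\<^bsub>G\<^esub> (frac_part G \<Gamma> \<psi> d (g_lin G l g h))
                   \<otimes>\<^bsub>G\<^esub> g_two G l g (vec_add n h)
                   \<otimes>\<^bsub>G\<^esub> g_lin G l g (vec_add n h)
                   \<otimes>\<^bsub>G\<^esub> inv\<^bsub>G\<^esub> (int_part G \<Gamma> \<psi> d (g_lin G l g h)),
                 g n))"
proof -
  interpret prefiltered_group G Gs l
    using assms(1,2) by (rule filtration_imp_prefiltered_group)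
  interpret sq: prefiltered_group "G \<times>\<times> G" fiber_level l
    by (rule prefiltered_group_fiber_level)
  have Gs01: "Gs 0 = carrier G" "Gs 1 = carrier G" and "\<exists>s. \<forall>i\<ge>s. Gs i = {\<one>\<^bsub>G\<^esub>}"
    using assms(2) by (auto simp: filtration_def)
  then obtain s where s: "\<forall>i\<ge>s. Gs i = {\<one>\<^bsub>G\<^esub>}" by blast
  note h = assms(7)
  have g: "pseq 0 g" by (rule poly_seq_imp_pseq[OF assms(5)])
  note gc = pseq_carrier[OF g]
  have lin: "pseq 0 (g_lin G l g)"
    by (intro pseq_g_lin) (simp only: Gs01 gc length_unit_vec)
  define k where "k = g_lin G l g h"
  define a where "a = frac_part G \<Gamma> \<psi> d k"
  define b where "b = int_part G \<Gamma> \<psi> d k"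
  have kc: "k \<in> carrier G" unfolding k_def by (rule pseq_carrier[OF lin h])
  then have ac: "a \<in> carrier G" unfolding a_def by (rule frac_part_closed[OF assms(4)])
  then have bc: "b \<in> carrier G" and k: "k = a \<otimes>\<^bsub>G\<^esub> b"
    using kc by (simp_all add: b_def int_part_def mult_inv_cancel flip: a_def)
  let ?g = "\<lambda>n. g (vec_add n h)"
  note gc' = pseq_carrier[OF pseq_shift[OF g h]]
  \<comment> \<open>The product collapses to \<open>g b ?g^-1 a\<close>; it is spelled out as a
    conjugate of \<open>b\<close>, a conjugate of an inverse derivative and the constant
    \<open>a\<close>, each of level 1.\<close>
  define w where "w n = (g n \<otimes>\<^bsub>G\<^esub> b \<otimes>\<^bsub>G\<^esub> inv\<^bsub>G\<^esub> g n) \<otimes>\<^bsub>G\<^esub>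
    (g n \<otimes>\<^bsub>G\<^esub> inv\<^bsub>G\<^esub> (inv\<^bsub>G\<^esub> g n \<otimes>\<^bsub>G\<^esub> ?g n) \<otimes>\<^bsub>G\<^esub> inv\<^bsub>G\<^esub> g n) \<otimes>\<^bsub>G\<^esub> a" for n
  have "pseq 1 w"
    unfolding w_def
  proof (rule pseq.mult[OF pseq.mult])
    show "pseq 1 (\<lambda>n. g n \<otimes>\<^bsub>G\<^esub> b \<otimes>\<^bsub>G\<^esub> inv\<^bsub>G\<^esub> g n)"
      by (rule pseq_conjugate[OF g pseq_const]) (simp only: Gs01 bc)
    show "pseq 1 (\<lambda>n. g n \<otimes>\<^bsub>G\<^esub> inv\<^bsub>G\<^esub> (inv\<^bsub>G\<^esub> g n \<otimes>\<^bsub>G\<^esub> ?g n) \<otimes>\<^bsub>G\<^esub> inv\<^bsub>G\<^esub> g n)"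
      using pseq_conjugate[OF g pseq.inverse[OF pseq_derivative[OF g h]]] by simp
    show "pseq 1 (\<lambda>n. a)"
      by (rule pseq_const) (simp only: Gs01 ac)
  qed
  from pseq_fst[OF pseq.inverse[OF this]] have "sq.pseq 0 (\<lambda>n. (inv\<^bsub>G\<^esub> w n, \<one>\<^bsub>G\<^esub>))" by simp
  from sq.pseq.mult[OF this pseq_diagonal[OF g]]
  have "sq.pseq 0 (\<lambda>n. (inv\<^bsub>G\<^esub> w n \<otimes>\<^bsub>G\<^esub> g n, \<one>\<^bsub>G\<^esub> \<otimes>\<^bsub>G\<^esub> g n))" by simp
  then have F: "sq.pseq 0 (\<lambda>n. (inv\<^bsub>G\<^esub> a \<otimes>\<^bsub>G\<^esub> ?g n \<otimes>\<^bsub>G\<^esub> inv\<^bsub>G\<^esub> b, g n))"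
    by (rule sq.pseq.eq_on) (simp add: w_def group_word_simps ac bc gc gc')
  have gh: "g h \<in> carrier G" by (rule gc[OF h])
  \<comment> \<open>Since \<open>k = a b\<close>, the inverse of \<open>a^-1 g(h) b^-1\<close> is
    the conjugate by \<open>b\<close> of the inverse of \<open>k^-1 g(h)\<close>, which lies in
    \<open>Gs 2\<close>.\<close>
  have "b \<otimes>\<^bsub>G\<^esub> inv\<^bsub>G\<^esub> (inv\<^bsub>G\<^esub> k \<otimes>\<^bsub>G\<^esub> g h) \<otimes>\<^bsub>G\<^esub> inv\<^bsub>G\<^esub> b \<in> Gs 2"
    unfolding k_def using g_lin_congruent[OF g Gs01(2)[folded Gs01(1)] assms(6) h] bc
    by (intro Hs_conjugate Hs_inv) (simp_all add: Gs01)
  then have "\<one>\<^bsub>G\<^esub> \<otimes>\<^bsub>G\<^esub> inv\<^bsub>G\<^esub> (inv\<^bsub>G\<^esub> a \<otimes>\<^bsub>G\<^esub> g h \<otimes>\<^bsub>G\<^esub> inv\<^bsub>G\<^esub> b) \<in> Gs 2"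
    using ac bc gh by (simp add: k group_word_simps)
  then have F0: "(inv\<^bsub>G\<^esub> a \<otimes>\<^bsub>G\<^esub> ?g (replicate l 0) \<otimes>\<^bsub>G\<^esub> inv\<^bsub>G\<^esub> b, g (replicate l 0))
      \<in> fiber_prod G (carrier G) (Gs 2)"
    using ac bc gh by (simp add: fiber_prod_def vec_add_replicate_0[OF h] assms(6))
  have eq: "inv\<^bsub>G\<^esub> a \<otimes>\<^bsub>G\<^esub> g_two G l g (vec_add n h) \<otimes>\<^bsub>G\<^esub> g_lin G l g (vec_add n h) \<otimes>\<^bsub>G\<^esub> inv\<^bsub>G\<^esub> b
      = inv\<^bsub>G\<^esub> a \<otimes>\<^bsub>G\<^esub> ?g n \<otimes>\<^bsub>G\<^esub> inv\<^bsub>G\<^esub> b" if "length n = l" for n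
    using ac bc gc'[OF that] pseq_carrier[OF pseq_shift[OF lin h] that]
    by (simp add: g_two_def group_word_simps)
  show ?thesis
    unfolding k_def[symmetric] a_def[symmetric] b_def[symmetric]
  proof (rule poly_seq_square_group[OF prefiltered_group_axioms Gs01(2) s])
    show "sq.pseq 0 (\<lambda>n. (inv\<^bsub>G\<^esub> a \<otimes>\<^bsub>G\<^esub> g_two G l g (vec_add n h)
        \<otimes>\<^bsub>G\<^esub> g_lin G l g (vec_add n h) \<otimes>\<^bsub>G\<^esub> inv\<^bsub>G\<^esub> b, g n))"
      by (rule sq.pseq.eq_on[OF F]) (simp add: eq)
  qed (simp only: eq[OF length_replicate] F0)
qed

end
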